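(* Let $F$ be a gauge on $\mathbb{R}^2$ whose unit circle $S=\{x:F(x)=1\}$ is smooth and strictly convex, with associated gauge $F_a$, and let $\gamma(s)$ be an oriented smooth curve in $(\mathbb{R}^2,F)$ parametrized by $F$-arc length, $F(\gamma'(s))=1$. Then the circular curvature $k_c$ of $\gamma$ (with respect to $F$) is the normal curvature $k_n^a$ of $\gamma$ with respect to the associated gauge $F_a$; that is, if $s_a=s_a(s)$ denotes the arc length of $\gamma$ with respect to $F_a$, then $$k_c(s)=k_n^a(s_a(s)).$$
   Context: A gauge on $\mathbb{R}^2$ is a function $F:\mathbb{R}^2\to\mathbb{R}$ with $F(x)\ge 0$, $F(x)=0\Leftrightarrow x=0$; $F(\lambda x)=\lambda F(x)$ for $\lambda>0$; $F(x+y)\le F(x)+F(y)$ (no symmetry assumed). For $x=(x_1,x_2)$, $y=(y_1,y_2)$ put $[x,y]=x_1y_2-x_2y_1$. The associated gauge is $F_a(x)=\sup\{[y,x]:F(y)=1\}$; the gauge $F_{a,a}=(F_a)_a$ associated to $F_a$ satisfies $F_{a,a}(x)=F(-x)$. Birkhoff orthogonality with respect to $F_a$: $x\dashv_B^a y$ means $[x,y]=F_a(x)F_{a,a}(y)$. Circular curvature (with respect to $F$): let $\varphi(t)$ be a counter-clockwise parametrization of $S$ by $F$-arc length, $F(\varphi'(t))=1$. Write $\gamma'(s)=\varphi'(t(s))$. Then $k_c(s):=t'(s)$. Normal curvature with respect to $F_a$: let $s_a$ be the arc-length parameter of $\gamma$ for $F_a$, i.e. $ds_a/ds=F_a(\gamma'(s))$,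 so $F_a(d\gamma/ds_a)=1$. The right normal vector field $n_\gamma^a(s_a)$ of $\gamma$ with respect to $F_a$ is the vector with $F_{a,a}(n_\gamma^a)=1$ and $\frac{d\gamma}{ds_a}(s_a)\dashv_B^a n_\gamma^a(s_a)$. Let $\psi_a(v)$ be a counter-clockwise parametrization of $S_{a,a}=\{x:F_{a,a}(x)=1\}$ by arc length with respect to the gauge associated to $F_{a,a}$, i.e. $F_a(-\psi_a'(v))=1$. Write $n_\gamma^a(s_a)=\psi_a(v_a(s_a))$. Then $k_n^a(s_a):=v_a'(s_a)$. *)

theory Defs
  imports "HOL-Analysis.Analysis"
begin

definition gauge_on_plane :: "(real^2 \<Rightarrow> real) \<Rightarrow> bool" where
  "gauge_on_plane F \<longleftrightarrow>
     (\<forall>x. 0 \<le> F x) \<and> (\<forall>x. F x = 0 \<longleftrightarrow> x = 0) \<and>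
     (\<forall>c x. 0 < c \<longrightarrow> F (c *\<^sub>R x) = c * F x) \<and>
     (\<forall>x y. F (x + y) \<le> F x + F y)"

definition bracket :: "real^2 \<Rightarrow> real^2 \<Rightarrow> real" where
  "bracket x y = x$1 * y$2 - x$2 * y$1"

definition unit_circle :: "(real^2 \<Rightarrow> real) \<Rightarrow> (real^2) set" where
  "unit_circle F = {x. F x = 1}"

definition assoc_gauge :: "(real^2 \<Rightarrow> real) \<Rightarrow> real^2 \<Rightarrow> real" where
  "assoc_gauge F x = (SUP y\<in>unit_circle F. bracket y x)"

text \<open>Smoothness of the unit circle in the sense of convex geometry: there is exactly one
  supporting line of the unit ball at each of its boundary points.  A supporting line is
  represented by its Euclidean outward unit normal, which determines it (and is determined by
  it, the origin being interior to the ball).\<close>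

definition smooth_unit_circle :: "(real^2 \<Rightarrow> real) \<Rightarrow> bool" where
  "smooth_unit_circle F \<longleftrightarrow>
     (\<forall>x\<in>unit_circle F. \<exists>!u. norm u = 1 \<and> (\<forall>y. F y \<le> 1 \<longrightarrow> u \<bullet> y \<le> u \<bullet> x))"

definition strictly_convex_unit_circle :: "(real^2 \<Rightarrow> real) \<Rightarrow> bool" where
  "strictly_convex_unit_circle F \<longleftrightarrow>
     (\<forall>x y. x \<noteq> y \<longrightarrow> \<not> closed_segment x y \<subseteq> unit_circle F)"

definition birkhoff_orthogonal :: "(real^2 \<Rightarrow> real) \<Rightarrow> real^2 \<Rightarrow> real^2 \<Rightarrow> bool" where
  "birkhoff_orthogonal G x y \<longleftrightarrow> bracket x y = G x * assoc_gauge G y"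

text \<open>Curves live on an arbitrary interval, possibly with end points, so derivatives are taken
  within it.  Smooth means continuously differentiable; no higher regularity is assumed, since
  the curvatures below are relations that hold only where the derivative defining them exists.\<close>

definition smooth_curve_on :: "real set \<Rightarrow> (real \<Rightarrow> real^2) \<Rightarrow> bool" where
  "smooth_curve_on I c \<longleftrightarrow>
     (\<forall>s\<in>I. c differentiable (at s within I)) \<and>
     continuous_on I (\<lambda>s. vector_derivative c (at s within I))"

definition arclength_curve_on ::
    "(real^2 \<Rightarrow> real) \<Rightarrow> real set \<Rightarrow> (real \<Rightarrow> real^2) \<Rightarrow> bool" where
  "arclength_curve_on G I c \<longleftrightarrow>
     smooth_curve_on I c \<and> (\<forall>s\<in>I. G (vector_derivative c (at s within I)) = 1)"

text \<open>Parametrizations of the closed curve \<open>S\<close> around the origin are taken on the whole line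
  (so \<open>S\<close> is traversed periodically), which avoids singling out a base point.  For such a curve,
  counter-clockwise means that the bracket of position and velocity is positive.\<close>

definition ccw_arclength_param ::
    "(real^2 \<Rightarrow> real) \<Rightarrow> (real^2) set \<Rightarrow> (real \<Rightarrow> real^2) \<Rightarrow> bool" where
  "ccw_arclength_param G S \<phi> \<longleftrightarrow>
     range \<phi> = S \<and> arclength_curve_on G UNIV \<phi> \<and>
     (\<forall>t. 0 < bracket (\<phi> t) (vector_derivative \<phi> (at t)))"

text \<open>The number \<open>k\<close> is the circular curvature at \<open>s\<close> of the curve \<open>c\<close>, parametrized by
  \<open>F\<close>-arc length on the interval \<open>I\<close>.  As \<open>\<phi>\<close> is periodic, \<open>t\<close> is only determined up to periods;
  continuity makes it a lift.\<close>

definition has_circular_curvature ::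
    "(real^2 \<Rightarrow> real) \<Rightarrow> (real \<Rightarrow> real^2) \<Rightarrow> real set \<Rightarrow> real \<Rightarrow> real \<Rightarrow> bool" where
  "has_circular_curvature F c I s k \<longleftrightarrow>
     (\<exists>\<phi> t. ccw_arclength_param F (unit_circle F) \<phi> \<and>
        continuous_on I t \<and>
        (\<forall>r\<in>I. vector_derivative c (at r within I) = vector_derivative \<phi> (at (t r))) \<and>
        (t has_real_derivative k) (at s within I))"

definition right_normal :: "(real^2 \<Rightarrow> real) \<Rightarrow> real^2 \<Rightarrow> real^2 \<Rightarrow> bool" where
  "right_normal G x n \<longleftrightarrow> assoc_gauge G n = 1 \<and> birkhoff_orthogonal G x n"

text \<open>The number \<open>k\<close> is the normal curvature at \<open>s\<close>, with respect to the gauge \<open>G\<close>, of the curve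
  \<open>c\<close>, parametrized by \<open>G\<close>-arc length on the interval \<open>I\<close>.  The unit circle of the associated
  gauge of \<open>G\<close> is itself measured by the gauge associated to that one, which is
  \<open>x \<mapsto> G (- x)\<close>.\<close>

definition has_normal_curvature ::
    "(real^2 \<Rightarrow> real) \<Rightarrow> (real \<Rightarrow> real^2) \<Rightarrow> real set \<Rightarrow> real \<Rightarrow> real \<Rightarrow> bool" where
  "has_normal_curvature G c I s k \<longleftrightarrow>
     (\<exists>n \<psi> v. (\<forall>r\<in>I. right_normal G (vector_derivative c (at r within I)) (n r)) \<and>
        ccw_arclength_param (assoc_gauge (assoc_gauge G)) (unit_circle (assoc_gauge G)) \<psi> \<and>
        continuous_on I v \<and>
        (\<forall>r\<in>I. n r = \<psi> (v r)) \<and>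
        (v has_real_derivative k) (at s within I))"

end

theory Submission
  imports Defs
begin

text \<open>If \<open>\<gamma>' = \<phi>'(t)\<close>, then the unit circle has tangent direction \<open>\<gamma>'\<close> at \<open>\<phi>(t)\<close>, so \<open>\<phi>(t)\<close> maximizes
  \<open>[y, \<gamma>']\<close> over \<open>F(y) = 1\<close>.  Since \<open>F\<^sub>a\<^sub>,\<^sub>a(x) = F(-x)\<close>, this says exactly that the right normal of \<open>\<gamma>\<close>
  with respect to \<open>F\<^sub>a\<close> is \<open>- \<phi>(t)\<close>; hence \<open>\<psi>\<^sub>a\<close> is \<open>- \<phi>\<close> up to a change of parameter, and conversely.  By
  strict convexity the maximizer is unique, so \<open>\<phi>(t(s)) = - \<psi>\<^sub>a(v\<^sub>a(s\<^sub>a(s)))\<close> for any admissible choices.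
  The \<open>s\<close>-derivatives of the two sides are \<open>k\<^sub>c \<gamma>'\<close> and \<open>k\<^sub>n \<gamma>'\<close>, because \<open>- \<psi>\<^sub>a'\<close> is the positive multiple
  of \<open>\<gamma>'\<close> with \<open>F\<^sub>a(- \<psi>\<^sub>a') = 1\<close> and \<open>s\<^sub>a' = F\<^sub>a(\<gamma>')\<close>.\<close>

section \<open>The area form on the plane\<close>

interpretation bracket: bounded_bilinear bracket
proof -
  \<comment> \<open>A clockwise quarter turn of the second argument turns the bracket into the inner
    product, whose boundedness carries over.\<close>
  have eq: "bracket = (\<lambda>x y. x \<bullet> (vector [y$2, - y$1] :: real^2))"
    by (intro ext) (simp add: bracket_def inner_vec_def sum_2)
  have "bounded_linear (\<lambda>y. vector [y$2, - y$1] :: real^2)"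
    unfolding linear_conv_bounded_linear[symmetric]
    by (intro linearI) (auto simp: vec_eq_iff forall_2)
  then show "bounded_bilinear bracket"
    unfolding eq by (rule bounded_bilinear.comp[OF bounded_bilinear_inner bounded_linear_ident])
qed

lemma bracket_swap: "bracket y x = - bracket x y"
  by (simp add: bracket_def)

lemma bracket_eq_0_imp_scaleR:
  assumes "bracket x w = 0" and "w \<noteq> 0"
  obtains c where "x = c *\<^sub>R w"
proof (cases "w $ 1 = 0")
  case True
  with assms have "w $ 2 \<noteq> 0" by (auto simp: vec_eq_iff forall_2)
  with True assms have "x = (x$2 / w$2) *\<^sub>R w"
    by (auto simp: vec_eq_iff forall_2 bracket_def)
  then show ?thesis by (rule that)
next
  case False
  with assms have "x = (x$1 / w$1) *\<^sub>R w"
    by (auto simp: vec_eq_iff forall_2 bracket_def field_simps)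
  then show ?thesis by (rule that)
qed

text \<open>The vector \<open>w\<close> is \<open>u\<close> turned counter-clockwise by a right
  angle. This translates Euclidean normals of supporting lines into bracket functionals.\<close>

lemma inner_eq_bracket:
  fixes u :: "real^2"
  obtains w where "\<And>y. u \<bullet> y = bracket y w"
  by (rule that[of "vector [- u$2, u$1]"]) (simp add: bracket_def inner_vec_def sum_2 algebra_simps)

section \<open>Gauges and their associated gauges\<close>

context
  fixes F :: "real^2 \<Rightarrow> real"
  assumes F: "gauge_on_plane F"
begin

lemma gauge_nonneg: "0 \<le> F x"
  using F by (simp add: gauge_on_plane_def)

lemma gauge_eq_0_iff: "F x = 0 \<longleftrightarrow> x = 0"
  using F by (simp add: gauge_on_plane_def)

lemma gauge_zero: "F 0 = 0"
  by (simp add: gauge_eq_0_iff)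

lemma gauge_pos_iff: "0 < F x \<longleftrightarrow> x \<noteq> 0"
  using gauge_nonneg[of x] gauge_eq_0_iff[of x] by linarith

lemmas gauge_simps = gauge_nonneg gauge_zero gauge_eq_0_iff gauge_pos_iff

lemma gauge_scaleR: "0 \<le> c \<Longrightarrow> F (c *\<^sub>R x) = c * F x"
  using F by (cases "c = 0") (auto simp: gauge_on_plane_def)

lemma gauge_add: "F (x + y) \<le> F x + F y"
  using F by (simp add: gauge_on_plane_def)

lemma gauge_normalize: "x \<noteq> 0 \<Longrightarrow> F (x /\<^sub>R F x) = 1"
  by (simp add: gauge_scaleR gauge_simps)

lemma convex_on_gauge: "convex_on UNIV F"
proof (rule convex_onI)
  show "F ((1 - t) *\<^sub>R x + t *\<^sub>R y) \<le> (1 - t) * F x + t * F y" if "0 < t" "t < 1" for t x y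
    using gauge_add[of "(1 - t) *\<^sub>R x" "t *\<^sub>R y"] that by (simp add: gauge_scaleR)
qed simp

text \<open>A finite convex function on the plane is automatically continuous.\<close>

lemma continuous_on_gauge: "continuous_on A F"
  using convex_on_continuous[OF open_UNIV convex_on_gauge] continuous_on_subset by blast

lemma gauge_uminus: "gauge_on_plane (\<lambda>x. F (- x))"
  using gauge_add[of "- x" "- y" for x y] gauge_scaleR[of c "- x" for c x]
  by (auto simp: gauge_on_plane_def gauge_simps)

end

lemma gauge_norm: "gauge_on_plane norm"
  by (simp add: gauge_on_plane_def norm_triangle_ineq)

text \<open>The quotient \<open>G x / F x\<close> attains a positive minimum on the compact
  Euclidean unit circle, and homogeneity extends the bound to all vectors.\<close>

lemma gauge_comparison:
  assumes F: "gauge_on_plane F" and G: "gauge_on_plane G"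
  obtains c where "0 < c" and "\<And>x. c * F x \<le> G x"
proof -
  have "continuous_on (sphere 0 1) (\<lambda>x. G x / F x)"
    by (intro continuous_on_divide continuous_on_gauge F G) (auto simp: gauge_simps[OF F])
  moreover have "sphere 0 1 \<noteq> ({} :: (real^2) set)" by simp
  ultimately obtain x0 where x0: "norm x0 = 1"
    and min: "\<And>x. norm x = 1 \<Longrightarrow> G x0 / F x0 \<le> G x / F x"
    using continuous_attains_inf[of "sphere (0::real^2) 1"] by force
  have nz: "x0 \<noteq> 0" using x0 by auto
  show ?thesis
  proof (rule that[of "G x0 / F x0"])
    show "0 < G x0 / F x0" using nz by (simp add: gauge_simps[OF F] gauge_simps[OF G])
    show "G x0 / F x0 * F x \<le> G x" for x
    proof (cases "x = 0")
      case False
      have "G x0 / F x0 \<le> G (x /\<^sub>R norm x) / F (x /\<^sub>R norm x)"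
        by (rule min) (simp add: False)
      also have "\<dots> = G x / F x" by (simp add: gauge_scaleR F G False gauge_simps)
      finally show ?thesis using False by (simp add: gauge_simps[OF F] field_simps)
    qed (simp add: gauge_zero F G)
  qed
qed

context
  fixes F :: "real^2 \<Rightarrow> real"
  assumes F: "gauge_on_plane F"
begin

lemma unit_circle_nonempty: "unit_circle F \<noteq> {}"
proof -
  have "axis 1 1 \<noteq> (0 :: real^2)" by simp
  from gauge_normalize[OF F this] show ?thesis by (auto simp: unit_circle_def)
qed

text \<open>Comparison with the Euclidean norm puts the unit circle into a disc of radius
  \<open>1 / c\<close>. Hence the supremum defining \<open>assoc_gauge\<close> is a genuine
  one.\<close>

lemma bdd_above_bracket_unit_circle: "bdd_above ((\<lambda>y. bracket y x) ` unit_circle F)"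
proof -
  obtain c where c: "0 < c" "\<And>x. c * norm x \<le> F x"
    using gauge_comparison[OF gauge_norm F] by blast
  obtain K where K: "0 \<le> K" "\<And>x y. norm (bracket x y) \<le> norm x * norm y * K"
    using bracket.nonneg_bounded by blast
  have "bracket y x \<le> (1 / c) * norm x * K" if "F y = 1" for y
  proof -
    have "norm y \<le> 1 / c" using c(1) c(2)[of y] that by (simp add: field_simps)
    then have "norm y * norm x * K \<le> (1 / c) * norm x * K"
      by (intro mult_right_mono) (use K in auto)
    with K(2)[of y x] show ?thesis by simp
  qed
  then show ?thesis by (intro bdd_aboveI2) (simp add: unit_circle_def)
qed

text \<open>The duality inequality between a gauge and its associated gauge: normalize
  \<open>y\<close> to the unit circle and use homogeneity.\<close>

lemma bracket_le_assoc_gauge: "bracket y x \<le> F y * assoc_gauge F x"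
proof (cases "y = 0")
  case False
  have "bracket (y /\<^sub>R F y) x \<le> assoc_gauge F x"
    unfolding assoc_gauge_def
    by (rule cSUP_upper[OF _ bdd_above_bracket_unit_circle])
      (simp add: unit_circle_def gauge_normalize[OF F False])
  then show ?thesis using False by (simp add: bracket.scaleR_left gauge_simps[OF F] field_simps)
qed (simp add: gauge_simps[OF F] bracket.zero_left)

lemma assoc_gauge_eqI:
  assumes "F y = 1" and "\<And>z. F z = 1 \<Longrightarrow> bracket z x \<le> bracket y x"
  shows "assoc_gauge F x = bracket y x"
  unfolding assoc_gauge_def
  by (rule cSup_eq_maximum) (use assms in \<open>auto simp: unit_circle_def\<close>)

lemma assoc_gauge_leI:
  assumes "\<And>y. F y = 1 \<Longrightarrow> bracket y x \<le> B"
  shows "assoc_gauge F x \<le> B"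
  unfolding assoc_gauge_def
  by (rule cSUP_least[OF unit_circle_nonempty]) (simp add: assms unit_circle_def)

lemma assoc_gauge_pos: "x \<noteq> 0 \<Longrightarrow> 0 < assoc_gauge F x"
proof -
  assume x: "x \<noteq> 0"
  \<comment> \<open>The vector \<open>x\<close> turned clockwise by a right angle, so that
    \<open>bracket y x\<close> is the squared Euclidean norm of \<open>x\<close>.\<close>
  define y :: "real^2" where "y = vector [x$2, - x$1]"
  have b: "0 < bracket y x"
    using x by (auto simp: bracket_def y_def vec_eq_iff forall_2 sum_power2_gt_zero_iff
        simp flip: power2_eq_square)
  then have "y \<noteq> 0" by (auto simp: bracket.zero_left)
  with b show ?thesis
    using bracket_le_assoc_gauge[of y x] gauge_pos_iff[OF F, of y]
    by (metis order_less_le_trans zero_less_mult_pos)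
qed

lemma assoc_gauge_gauge: "gauge_on_plane (assoc_gauge F)"
proof -
  have zero: "assoc_gauge F 0 = 0"
    using unit_circle_nonempty by (simp add: assoc_gauge_def bracket.zero_right)
  have scale_le: "assoc_gauge F (c *\<^sub>R x) \<le> c * assoc_gauge F x" if "0 < c" for c x
    by (rule assoc_gauge_leI)
      (metis bracket.scaleR_right bracket_le_assoc_gauge less_imp_le mult.left_neutral
        mult_left_mono real_scaleR_def that)
  \<comment> \<open>The reverse inequality is \<open>scale_le\<close> for the inverse
    factor.\<close>
  have scale: "assoc_gauge F (c *\<^sub>R x) = c * assoc_gauge F x" if "0 < c" for c x
    using scale_le[OF that, of x] scale_le[of "inverse c" "c *\<^sub>R x"] that
    by (simp add: field_simps)
  have "assoc_gauge F (x + y) \<le> assoc_gauge F x + assoc_gauge F y" for x y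
    by (rule assoc_gauge_leI)
      (metis add_mono bracket.add_right bracket_le_assoc_gauge mult.left_neutral)
  then show ?thesis
    unfolding gauge_on_plane_def using zero scale assoc_gauge_pos
    by (metis less_eq_real_def less_irrefl)
qed

text \<open>The normal of a supporting line at \<open>z\<close>, written as a bracket functional,
  gives a direction whose supremum is attained at \<open>z\<close>. Rescaling makes this value
  1.\<close>

lemma supporting_vector:
  assumes "smooth_unit_circle F" and z: "F z = 1"
  obtains w where "assoc_gauge F w = 1" and "bracket z w = 1"
proof -
  obtain u where u: "norm u = 1" "\<And>y. F y \<le> 1 \<Longrightarrow> u \<bullet> y \<le> u \<bullet> z"
    using assms unfolding smooth_unit_circle_def unit_circle_def by blast
  obtain w where w: "\<And>y. u \<bullet> y = bracket y w"
    using inner_eq_bracket by blast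
  have eq: "assoc_gauge F w = bracket z w"
    by (rule assoc_gauge_eqI[OF z]) (use u w in auto)
  have "w \<noteq> 0" using u(1) w[of u] by (auto simp: bracket.zero_right)
  then have pos: "0 < assoc_gauge F w" by (rule assoc_gauge_pos)
  show ?thesis
    by (rule that[of "w /\<^sub>R assoc_gauge F w"])
      (use pos eq in \<open>auto simp: gauge_scaleR[OF assoc_gauge_gauge] bracket.scaleR_right\<close>)
qed

end

text \<open>The bidual of a gauge, with a reflection caused by the antisymmetry of the bracket. The
  duality inequality bounds the supremum, and a supporting vector at the normalization of
  \<open>- x\<close> attains it.\<close>

lemma assoc_assoc_gauge:
  assumes F: "gauge_on_plane F" and "smooth_unit_circle F"
  shows "assoc_gauge (assoc_gauge F) = (\<lambda>x. F (- x))"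
proof
  fix x
  note A = assoc_gauge_gauge[OF F]
  show "assoc_gauge (assoc_gauge F) x = F (- x)"
  proof (cases "x = 0")
    case False
    then have "F ((- x) /\<^sub>R F (- x)) = 1" by (intro gauge_normalize F) simp
    then obtain w where w: "assoc_gauge F w = 1" "bracket ((- x) /\<^sub>R F (- x)) w = 1"
      using supporting_vector assms by blast
    from w(2) have eq: "bracket w x = F (- x)"
      using False by (simp add: gauge_simps[OF F] bracket.scaleR_left bracket.minus_left bracket_swap[of x w]
          field_simps split: if_splits)
    have "bracket z x \<le> F (- x)" if "assoc_gauge F z = 1" for z
      using bracket_le_assoc_gauge[OF F, of "- x" z] that
      by (simp add: bracket.minus_left bracket_swap[of x z])
    then show ?thesis using assoc_gauge_eqI[OF A w(1), of x] eq by simp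
  qed (simp add: gauge_zero F A assoc_gauge_gauge)
qed

text \<open>Substituting \<open>- y\<close> for \<open>y\<close> in the supremum moves the sign from
  the unit circle to \<open>x\<close>.\<close>

lemma assoc_gauge_uminus: "assoc_gauge (\<lambda>x. F (- x)) x = assoc_gauge F (- x)"
proof -
  have "unit_circle (\<lambda>x. F (- x)) = uminus ` unit_circle F"
    by (force simp: unit_circle_def image_iff intro: exI[of _ "- x" for x])
  then show ?thesis
    by (simp add: assoc_gauge_def image_image bracket.minus_left bracket.minus_right)
qed

section \<open>Tangents of the unit circle\<close>

text \<open>The segment between two maximizers would lie on the unit circle.\<close>

lemma bracket_maximizer_unique:
  assumes F: "gauge_on_plane F" and sc: "strictly_convex_unit_circle F" and w: "w \<noteq> 0"
    and x: "F x = 1" "bracket x w = assoc_gauge F w"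
    and y: "F y = 1" "bracket y w = assoc_gauge F w"
  shows "x = y"
proof (rule ccontr)
  assume "x \<noteq> y"
  have "F z = 1" if z: "z \<in> closed_segment x y" for z
  proof (rule antisym)
    obtain u where u: "0 \<le> u" "u \<le> 1" "z = (1 - u) *\<^sub>R x + u *\<^sub>R y"
      using z by (auto simp: closed_segment_def)
    show "F z \<le> 1"
      using gauge_add[OF F, of "(1 - u) *\<^sub>R x" "u *\<^sub>R y"] u x y by (simp add: gauge_scaleR F)
    have "bracket z w = assoc_gauge F w"
      unfolding u(3) using x(2) y(2)
      by (simp add: bracket.add_left bracket.diff_left bracket.scaleR_left algebra_simps)
    with bracket_le_assoc_gauge[OF F, of z w] assoc_gauge_pos[OF F w] show "1 \<le> F z"
      by simp
  qed
  then have "closed_segment x y \<subseteq> unit_circle F" by (auto simp: unit_circle_def)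
  with sc \<open>x \<noteq> y\<close> show False by (auto simp: strictly_convex_unit_circle_def)
qed

text \<open>The function \<open>bracket (\<phi> \<tau>) w\<close> has a global maximum at
  \<open>t\<close>, so its derivative \<open>bracket d w\<close> vanishes and \<open>d\<close> is
  parallel to \<open>w\<close>. The counter-clockwise orientation makes the factor positive.\<close>

lemma velocity_at_maximizer:
  assumes F: "gauge_on_plane F" and "w \<noteq> 0"
    and der: "(\<phi> has_vector_derivative d) (at t)"
    and circ: "\<And>\<tau>. F (\<phi> \<tau>) = 1"
    and max: "bracket (\<phi> t) w = assoc_gauge F w"
    and ccw: "0 < bracket (\<phi> t) d"
  obtains c where "0 < c" and "d = c *\<^sub>R w"
proof -
  have "((\<lambda>\<tau>. bracket (\<phi> \<tau>) w) has_real_derivative bracket d w) (at t)"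
    unfolding has_real_derivative_iff_has_vector_derivative
    by (rule bounded_linear.has_vector_derivative[OF bracket.bounded_linear_left der])
  moreover have "bracket (\<phi> \<tau>) w \<le> bracket (\<phi> t) w" for \<tau>
    using bracket_le_assoc_gauge[OF F, of "\<phi> \<tau>" w] circ max by simp
  ultimately have "bracket d w = 0"
    using DERIV_local_max[of "\<lambda>\<tau>. bracket (\<phi> \<tau>) w" _ t 1] by auto
  then obtain c where c: "d = c *\<^sub>R w"
    using bracket_eq_0_imp_scaleR \<open>w \<noteq> 0\<close> by blast
  have "0 < c * assoc_gauge F w" using ccw c max by (simp add: bracket.scaleR_right)
  then have "0 < c" using assoc_gauge_pos[OF F \<open>w \<noteq> 0\<close>] by (simp add: zero_less_mult_iff)
  then show ?thesis using c by (rule that)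
qed

section \<open>Changes of parameter\<close>

context
  fixes f f' :: "real \<Rightarrow> real" and I :: "real set"
  assumes I: "is_interval I"
    and der: "\<And>x. x \<in> I \<Longrightarrow> (f has_real_derivative f' x) (at x within I)"
    and pos: "\<And>x. x \<in> I \<Longrightarrow> 0 < f' x"
begin

lemma pos_deriv_continuous_on: "continuous_on I f"
  unfolding continuous_on_eq_continuous_within using der by (blast intro: DERIV_continuous)

lemma pos_deriv_strict_mono_on: "strict_mono_on I f"
proof (rule strict_mono_onI)
  fix a b assume ab: "a \<in> I" "b \<in> I" "a < b"
  then have sub: "{a..b} \<subseteq> I" using I by (meson atLeastAtMost_iff mem_is_interval_1_I subsetI)
  show "f a < f b"
  proof (rule DERIV_pos_imp_increasing_open[OF \<open>a < b\<close>])
    show "\<exists>y. DERIV f x :> y \<and> y > 0" if "a < x" "x < b" for x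
    proof (intro exI conjI)
      have "x \<in> I" using that sub by auto
      then show "0 < f' x" by (rule pos)
      \<comment> \<open>At points strictly between \<open>a\<close> and \<open>b\<close> the
        derivative within \<open>I\<close> is an ordinary two-sided one.\<close>
      have "(f has_real_derivative f' x) (at x within {a<..<b})"
        using der[OF \<open>x \<in> I\<close>] by (rule DERIV_subset) (use sub in auto)
      then show "DERIV f x :> f' x" using that by (simp add: at_within_open_NO_MATCH)
    qed
    show "continuous_on {a..b} f"
      using pos_deriv_continuous_on sub continuous_on_subset by blast
  qed
qed

lemma pos_deriv_inj_on: "inj_on f I"
  using pos_deriv_strict_mono_on by (rule strict_mono_on_imp_inj_on)

text \<open>A continuous injection of an interval into the line is a homeomorphism onto its
  image.\<close>

lemma pos_deriv_continuous_on_inv: "continuous_on (f ` I) (inv_into I f)"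
proof -
  obtain g where g: "homeomorphism I (f ` I) f g"
    using injective_into_1d_eq_homeomorphism[OF pos_deriv_continuous_on] pos_deriv_inj_on I
    by (auto simp: is_interval_path_connected)
  have "continuous_on (f ` I) g" using g by (simp add: homeomorphism_def)
  then show ?thesis
    by (rule continuous_on_eq)
      (use g pos_deriv_inj_on in \<open>auto simp: homeomorphism_def inv_into_f_f\<close>)
qed

lemma pos_deriv_inv:
  assumes x: "x \<in> I"
  shows "(inv_into I f has_real_derivative inverse (f' x)) (at (f x) within f ` I)"
  unfolding has_field_derivative_def
proof (rule has_derivative_inverse_within)
  show "(f has_derivative (*) (f' x)) (at x within I)"
    using der[OF x] by (simp add: has_field_derivative_def)
  show "continuous (at (f x) within f ` I) (inv_into I f)"
    using pos_deriv_continuous_on_inv x by (auto simp: continuous_on_eq_continuous_within)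
  show "linear ((*) (inverse (f' x)))" by (simp add: linear_times)
  show "(*) (inverse (f' x)) \<circ> (*) (f' x) = id" using pos[OF x] by (auto simp: fun_eq_iff)
qed (use x pos_deriv_inj_on in auto)

text \<open>The image is connected and infinite, so each of its points is a limit point. This makes
  derivatives within the image unique.\<close>

lemma at_within_pos_deriv_image_ne_bot:
  assumes "interior I \<noteq> {}" and "x \<in> I"
  shows "at (f x) within f ` I \<noteq> bot"
proof -
  have "infinite I" using assms(1) empty_interior_finite by blast
  then have "infinite (f ` I)" using pos_deriv_inj_on finite_imageD by blast
  moreover have "connected (f ` I)"
    by (intro connected_continuous_image pos_deriv_continuous_on)
      (simp add: I is_interval_connected)
  ultimately have "f x islimpt f ` I"
    by (intro connected_imp_perfect) (use assms(2) in auto)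
  then show ?thesis by (simp add: trivial_limit_within)
qed

end

text \<open>Since \<open>f x - c * x\<close> is nondecreasing, \<open>f\<close> is unbounded in both
  directions, and the intermediate value theorem applies.\<close>

lemma surj_deriv_bounded_below:
  fixes f f' :: "real \<Rightarrow> real"
  assumes der: "\<And>x. (f has_real_derivative f' x) (at x)" and "0 < c" and bound: "\<And>x. c \<le> f' x"
  shows "surj f"
proof -
  have incr: "c * (b - a) \<le> f b - f a" if "a \<le> b" for a b
  proof -
    have "f a - c * a \<le> f b - c * b"
    proof (rule DERIV_nonneg_imp_nondecreasing[OF that])
      fix x
      have "((\<lambda>x. f x - c * x) has_real_derivative f' x - c) (at x)"
        by (auto intro!: derivative_eq_intros der)
      then show "\<exists>y. ((\<lambda>x. f x - c * x) has_real_derivative y) (at x) \<and> 0 \<le> y"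
        using bound[of x] by force
    qed
    then show ?thesis by (simp add: algebra_simps)
  qed
  have "y \<in> range f" for y
  proof -
    \<comment> \<open>Over a length \<open>b\<close> the function \<open>f\<close> grows by at least
      the distance from \<open>f 0\<close> to \<open>y\<close>.\<close>
    define b where "b = \<bar>y - f 0\<bar> / c"
    have "0 \<le> b" "c * b = \<bar>y - f 0\<bar>" using \<open>0 < c\<close> by (auto simp: b_def)
    then have "f (- b) \<le> y" "y \<le> f b" using incr[of "- b" 0] incr[of 0 b] by auto
    moreover have "continuous_on {- b..b} f"
      using der DERIV_isCont continuous_at_imp_continuous_on by blast
    ultimately show ?thesis using IVT'[of f "- b" y b] \<open>0 \<le> b\<close> by auto
  qed
  then show ?thesis by auto
qed

text \<open>Here \<open>V\<close> is an antiderivative of the \<open>G\<close>-speed and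
  \<open>W\<close> its inverse. As the \<open>F\<close>-speed is 1, comparing the gauges keeps the
  \<open>G\<close>-speed above a positive constant. So \<open>V\<close> maps onto the whole line,
  which is the domain required of a parametrization.\<close>

lemma arclength_reparam:
  assumes F: "gauge_on_plane F" and G: "gauge_on_plane G"
    and \<phi>: "ccw_arclength_param F S \<phi>"
  defines "\<phi>' \<equiv> \<lambda>\<tau>. vector_derivative \<phi> (at \<tau>)"
  obtains V W where "\<And>\<tau>. (V has_real_derivative G (\<phi>' \<tau>)) (at \<tau>)"
    and "\<And>\<tau>. W (V \<tau>) = \<tau>"
    and "\<And>x. vector_derivative (\<phi> \<circ> W) (at x) = \<phi>' (W x) /\<^sub>R G (\<phi>' (W x))"
    and "ccw_arclength_param G S (\<phi> \<circ> W)"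
proof -
  have rng: "range \<phi> = S"
    and der: "(\<phi> has_vector_derivative \<phi>' \<tau>) (at \<tau>)"
    and cont: "continuous_on UNIV \<phi>'"
    and unit: "F (\<phi>' \<tau>) = 1"
    and ccw: "0 < bracket (\<phi> \<tau>) (\<phi>' \<tau>)" for \<tau>
    using \<phi> by (auto simp: ccw_arclength_param_def arclength_curve_on_def smooth_curve_on_def
        \<phi>'_def vector_derivative_works)
  define h where "h = (\<lambda>\<tau>. G (\<phi>' \<tau>))"
  have hcont: "continuous_on UNIV h"
    unfolding h_def using continuous_on_compose2[OF continuous_on_gauge[OF G] cont] by blast
  obtain c where c: "0 < c" "\<And>x. c * F x \<le> G x"
    using gauge_comparison[OF F G] by blast
  have lower: "c \<le> h \<tau>" for \<tau> using c(2)[of "\<phi>' \<tau>"] unit by (simp add: h_def)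
  have hpos: "0 < h \<tau>" for \<tau> using lower[of \<tau>] c(1) by linarith
  obtain V where V: "(V has_real_derivative h \<tau>) (at \<tau>)" for \<tau>
    using einterval_antiderivative[of "-\<infinity>" "\<infinity>" h] hcont
    by (auto simp: has_real_derivative_iff_has_vector_derivative
        continuous_on_eq_continuous_at)
  define W where "W = inv V"
  have surj: "surj V" using V c(1) lower by (rule surj_deriv_bounded_below)
  have WV: "W (V \<tau>) = \<tau>" for \<tau>
    unfolding W_def by (rule inv_f_f) (rule pos_deriv_inj_on[of UNIV, OF _ V hpos], simp)
  have VW: "V (W x) = x" for x
    unfolding W_def by (rule surj_f_inv_f[OF surj])
  have W: "(W has_real_derivative inverse (h (W x))) (at x)" for x
    using pos_deriv_inv[of UNIV V h "W x", OF _ V hpos] surj VW by (simp add: W_def)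
  have comp: "((\<phi> \<circ> W) has_vector_derivative \<phi>' (W x) /\<^sub>R h (W x)) (at x)" for x
    using vector_diff_chain_at[of W "inverse (h (W x))" x \<phi> "\<phi>' (W x)"] W der
    by (simp add: has_real_derivative_iff_has_vector_derivative)
  have vd: "vector_derivative (\<phi> \<circ> W) (at x) = \<phi>' (W x) /\<^sub>R h (W x)" for x
    using comp by (rule vector_derivative_at)
  have Wcont: "continuous_on UNIV W"
    using W DERIV_isCont continuous_at_imp_continuous_on by blast
  have "surj W" using WV by (metis surjI)
  then have "range (\<phi> \<circ> W) = S" using rng by (metis image_comp)
  moreover have "(\<phi> \<circ> W) differentiable (at x)" for x
    using comp by (rule differentiableI_vector)
  moreover have "continuous_on UNIV (\<lambda>x. \<phi>' (W x) /\<^sub>R h (W x))"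
    using continuous_on_compose2[OF cont Wcont] continuous_on_compose2[OF hcont Wcont] hpos
    by (intro continuous_intros) (auto simp: less_imp_neq[symmetric])
  moreover have "G (\<phi>' (W x) /\<^sub>R h (W x)) = 1" for x
    using hpos[of "W x"] by (simp add: gauge_scaleR[OF G] h_def)
  moreover have "0 < bracket (\<phi> (W x)) (\<phi>' (W x) /\<^sub>R h (W x))" for x
    using ccw hpos by (simp add: bracket.scaleR_right)
  ultimately have "ccw_arclength_param G S (\<phi> \<circ> W)"
    by (simp add: ccw_arclength_param_def arclength_curve_on_def smooth_curve_on_def vd)
  with V WV vd show ?thesis by (intro that) (auto simp: h_def)
qed

text \<open>Reflection in the origin keeps the orientation, because the bracket is unchanged when
  both arguments change sign.\<close>

lemma ccw_arclength_param_uminus: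
  assumes "ccw_arclength_param F S \<phi>"
  shows "ccw_arclength_param (\<lambda>x. F (- x)) (uminus ` S) (\<lambda>t. - \<phi> t)"
    and "vector_derivative (\<lambda>t. - \<phi> t) (at \<tau>) = - vector_derivative \<phi> (at \<tau>)"
proof -
  have der: "(\<phi> has_vector_derivative vector_derivative \<phi> (at t)) (at t)" for t
    using assms by (simp add: ccw_arclength_param_def arclength_curve_on_def smooth_curve_on_def
        flip: vector_derivative_works)
  have der': "((\<lambda>t. - \<phi> t) has_vector_derivative - vector_derivative \<phi> (at t)) (at t)" for t
    using der by (rule has_vector_derivative_minus)
  show vd: "vector_derivative (\<lambda>t. - \<phi> t) (at \<tau>) = - vector_derivative \<phi> (at \<tau>)" for \<tau>
    using der' by (rule vector_derivative_at)
  have "range (\<lambda>t. - \<phi> t) = uminus ` range \<phi>"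
    by (simp add: image_image)
  then show "ccw_arclength_param (\<lambda>x. F (- x)) (uminus ` S) (\<lambda>t. - \<phi> t)"
    using assms differentiableI_vector[OF der']
    by (simp add: ccw_arclength_param_def arclength_curve_on_def smooth_curve_on_def vd
        bracket.minus_left bracket.minus_right continuous_on_minus)
qed

section \<open>Circular and normal curvature\<close>

text \<open>The curvatures are relations, so equality of values alone would be vacuous where one of
  them is undefined. The equivalence of existence excludes this. Fixing only the derivative of
  \<open>s\<^sub>a\<close> leaves the base point of the arc length arbitrary.\<close>

theorem proposition3p2:
  fixes F :: "real^2 \<Rightarrow> real" and I :: "real set"
    and \<gamma> :: "real \<Rightarrow> real^2" and s\<^sub>a :: "real \<Rightarrow> real"
  assumes "gauge_on_plane F"
    and "smooth_unit_circle F"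
    and "strictly_convex_unit_circle F"
    and "is_interval I" and "interior I \<noteq> {}"
    and "arclength_curve_on F I \<gamma>"
    and "\<And>s. s \<in> I \<Longrightarrow>
      (s\<^sub>a has_real_derivative assoc_gauge F (vector_derivative \<gamma> (at s within I))) (at s within I)"
  defines "\<gamma>\<^sub>a \<equiv> \<gamma> \<circ> inv_into I s\<^sub>a"
  shows "\<forall>s\<in>I.
    ((\<exists>k. has_circular_curvature F \<gamma> I s k) \<longleftrightarrow>
     (\<exists>k. has_normal_curvature (assoc_gauge F) \<gamma>\<^sub>a (s\<^sub>a ` I) (s\<^sub>a s) k)) \<and>
    (\<forall>k\<^sub>c k\<^sub>n. has_circular_curvature F \<gamma> I s k\<^sub>c \<and>
       has_normal_curvature (assoc_gauge F) \<gamma>\<^sub>a (s\<^sub>a ` I) (s\<^sub>a s) k\<^sub>n \<longrightarrow> k\<^sub>c = k\<^sub>n)"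
proof -
  note F = assms(1) and smooth = assms(2) and sc = assms(3) and I = assms(4) and ds = assms(7)
  note Fa = assoc_gauge_gauge[OF F]
  note Faa = assoc_assoc_gauge[OF F smooth]
  \<comment> \<open>This is the gauge that measures arc length on the normal circle, which is the
    reflected unit circle of \<open>F\<close>.\<close>
  have Faaa: "assoc_gauge (assoc_gauge (assoc_gauge F)) = (\<lambda>x. assoc_gauge F (- x))"
    unfolding Faa by (rule ext) (rule assoc_gauge_uminus)
  note Faaa_gauge = gauge_uminus[OF Fa]
  have circ_aa: "unit_circle (assoc_gauge (assoc_gauge F)) = uminus ` unit_circle F"
    by (force simp: Faa unit_circle_def image_iff intro: exI[of _ "- x" for x])

  \<comment> \<open>Passing to arc length for the associated gauge\<close>
  define d where "d = (\<lambda>r. vector_derivative \<gamma> (at r within I))"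
  define p where "p = (\<lambda>r. assoc_gauge F (d r))"
  define g where "g = inv_into I s\<^sub>a"
  have \<gamma>: "(\<gamma> has_vector_derivative d r) (at r within I)" and dF: "F (d r) = 1" if "r \<in> I" for r
    using assms(6) that by (auto simp: arclength_curve_on_def smooth_curve_on_def d_def
        vector_derivative_works)
  have d_nz: "d r \<noteq> 0" if "r \<in> I" for r using dF[OF that] gauge_zero[OF F] by auto
  have p_pos: "0 < p r" if "r \<in> I" for r
    using assoc_gauge_pos[OF F d_nz[OF that]] by (simp add: p_def)
  have ds': "(s\<^sub>a has_real_derivative p r) (at r within I)" if "r \<in> I" for r
    using ds[OF that] by (simp add: p_def d_def)
  have gs: "g (s\<^sub>a r) = r" if "r \<in> I" for r
    using inv_into_f_f[OF pos_deriv_inj_on[OF I ds' p_pos] that] by (simp add: g_def)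
  have g_img: "g ` s\<^sub>a ` I = I" using gs by (force simp: image_image)
  have g_cont: "continuous_on (s\<^sub>a ` I) g"
    unfolding g_def by (rule pos_deriv_continuous_on_inv[OF I ds' p_pos])
  have s_cont: "continuous_on I s\<^sub>a"
    by (rule pos_deriv_continuous_on[OF I ds' p_pos])
  have g_der: "(g has_real_derivative inverse (p r)) (at (s\<^sub>a r) within s\<^sub>a ` I)" if "r \<in> I" for r
    unfolding g_def by (rule pos_deriv_inv[OF I ds' p_pos that])
  have \<gamma>a: "vector_derivative \<gamma>\<^sub>a (at (s\<^sub>a r) within s\<^sub>a ` I) = d r /\<^sub>R p r" if r: "r \<in> I" for r
  proof (rule vector_derivative_within)
    show "at (s\<^sub>a r) within s\<^sub>a ` I \<noteq> bot"
      by (rule at_within_pos_deriv_image_ne_bot[OF I ds' p_pos assms(5) r])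
    show "(\<gamma>\<^sub>a has_vector_derivative d r /\<^sub>R p r) (at (s\<^sub>a r) within s\<^sub>a ` I)"
      unfolding \<gamma>\<^sub>a_def g_def[symmetric]
      by (rule vector_diff_chain_within)
        (use g_der[OF r] \<gamma>[OF r] r in
          \<open>simp_all add: g_img gs has_real_derivative_iff_has_vector_derivative\<close>)
  qed

  \<comment> \<open>Right normals and maximizers of the bracket\<close>
  have right_normal_iff: "right_normal (assoc_gauge F) (d r /\<^sub>R p r) n \<longleftrightarrow>
      F (- n) = 1 \<and> bracket (- n) (d r) = assoc_gauge F (d r)" if r: "r \<in> I" for r n
    using p_pos[OF r]
    by (auto simp: right_normal_def birkhoff_orthogonal_def Faa gauge_scaleR[OF Fa]
        bracket.scaleR_left bracket.minus_left bracket_swap[of n] field_simps p_def)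

  \<comment> \<open>By \<open>velocity_at_maximizer\<close>, the velocity \<open>d r\<close> is a
    positive multiple of a supporting vector at \<open>\<phi> x\<close>, so \<open>\<phi> x\<close>
    maximizes the bracket with \<open>d r\<close> as well.\<close>
  have circular_maximizer: "F (\<phi> x) = 1 \<and> bracket (\<phi> x) (d r) = assoc_gauge F (d r)"
    if \<phi>: "ccw_arclength_param F (unit_circle F) \<phi>"
      and eq: "d r = vector_derivative \<phi> (at x)" and r: "r \<in> I" for \<phi> x r
  proof -
    have circ: "F (\<phi> \<tau>) = 1" and der: "(\<phi> has_vector_derivative d r) (at x)"
      and ccw: "0 < bracket (\<phi> x) (d r)" for \<tau>
      using \<phi> by (auto simp: ccw_arclength_param_def arclength_curve_on_def smooth_curve_on_def
          unit_circle_def eq vector_derivative_works)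
    obtain w where w: "assoc_gauge F w = 1" "bracket (\<phi> x) w = 1"
      using supporting_vector[OF F smooth circ] by blast
    have "w \<noteq> 0" using w(2) by (auto simp: bracket.zero_right)
    then obtain c where "0 < c" "d r = c *\<^sub>R w"
      using velocity_at_maximizer[OF F _ der circ _ ccw] w by metis
    with w circ show ?thesis by (simp add: bracket.scaleR_right gauge_scaleR[OF Fa])
  qed
  \<comment> \<open>The reflected curve \<open>- \<psi>\<close> runs counter-clockwise on the unit
    circle of \<open>F\<close>, so \<open>velocity_at_maximizer\<close> applies to it.\<close>
  have normal_velocity: "\<exists>c>0. vector_derivative \<psi> (at x) = - (c *\<^sub>R d r)"
    if \<psi>: "ccw_arclength_param (assoc_gauge (assoc_gauge (assoc_gauge F)))
        (unit_circle (assoc_gauge (assoc_gauge F))) \<psi>"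
      and max: "bracket (- \<psi> x) (d r) = assoc_gauge F (d r)" and r: "r \<in> I" for \<psi> x r
  proof -
    let ?d = "vector_derivative \<psi> (at x)"
    have circ: "F (- \<psi> \<tau>) = 1" and ccw: "0 < bracket (\<psi> x) ?d"
      and der: "(\<psi> has_vector_derivative ?d) (at x)" for \<tau>
      using \<psi> by (auto simp: ccw_arclength_param_def arclength_curve_on_def smooth_curve_on_def
          unit_circle_def Faa vector_derivative_works)
    obtain c where "0 < c" "- ?d = c *\<^sub>R d r"
      by (rule velocity_at_maximizer[OF F d_nz[OF r] has_vector_derivative_minus[OF der] circ max])
        (use ccw in \<open>simp_all add: bracket.minus_left bracket.minus_right\<close>)
    then show ?thesis by (metis minus_equation_iff)
  qed

  \<comment> \<open>From circular to normal curvature\<close>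
  have normal_of_circular: "\<exists>k. has_normal_curvature (assoc_gauge F) \<gamma>\<^sub>a (s\<^sub>a ` I) (s\<^sub>a s) k"
    if s: "s \<in> I" and circ: "has_circular_curvature F \<gamma> I s k" for s k
  proof -
    obtain \<phi> t where \<phi>: "ccw_arclength_param F (unit_circle F) \<phi>" and tc: "continuous_on I t"
      and eq: "\<And>r. r \<in> I \<Longrightarrow> d r = vector_derivative \<phi> (at (t r))"
      and dt: "(t has_real_derivative k) (at s within I)"
      using circ unfolding has_circular_curvature_def d_def by blast
    obtain V W where V: "\<And>\<tau>. (V has_real_derivative
          assoc_gauge F (- vector_derivative (\<lambda>t. - \<phi> t) (at \<tau>))) (at \<tau>)"
      and WV: "\<And>\<tau>. W (V \<tau>) = \<tau>"
      and \<psi>: "ccw_arclength_param (\<lambda>x. assoc_gauge F (- x)) (uminus ` unit_circle F)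
          ((\<lambda>t. - \<phi> t) \<circ> W)"
      by (rule arclength_reparam[OF gauge_uminus[OF F] Faaa_gauge
            ccw_arclength_param_uminus(1)[OF \<phi>]]) blast
    have Vc: "continuous_on UNIV V"
      using V DERIV_isCont continuous_at_imp_continuous_on by blast
    have max: "F (\<phi> (t r)) = 1 \<and> bracket (\<phi> (t r)) (d r) = assoc_gauge F (d r)"
      if "r \<in> I" for r
      by (rule circular_maximizer[OF \<phi> eq[OF that] that])
    \<comment> \<open>Since \<open>W\<close> undoes \<open>V\<close>, the reparametrized
      \<open>- \<phi>\<close> takes at \<open>v (s\<^sub>a r)\<close> the value
      \<open>- \<phi> (t r)\<close>, which is the right normal by \<open>max\<close>.\<close>
    define v where "v = V \<circ> (t \<circ> g)"
    have "((t \<circ> g) has_real_derivative k * inverse (p s)) (at (s\<^sub>a s) within s\<^sub>a ` I)"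
      by (rule DERIV_image_chain) (use g_der[OF s] dt s in \<open>simp_all add: g_img gs\<close>)
    then have "(v has_real_derivative
        assoc_gauge F (- vector_derivative (\<lambda>t. - \<phi> t) (at (t s))) * (k * inverse (p s)))
        (at (s\<^sub>a s) within s\<^sub>a ` I)"
      unfolding v_def using V[of "t s"] gs[OF s] by (intro DERIV_chain[of V _ "t \<circ> g"]) simp_all
    moreover have "continuous_on (s\<^sub>a ` I) v"
      unfolding v_def using continuous_on_compose[OF g_cont] tc Vc
      by (metis continuous_on_compose continuous_on_subset g_img subset_UNIV)
    moreover have "right_normal (assoc_gauge F)
        (vector_derivative \<gamma>\<^sub>a (at x within s\<^sub>a ` I)) (((\<lambda>t. - \<phi> t) \<circ> W) (v x))"
      if "x \<in> s\<^sub>a ` I" for x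
      using that max
      by (auto simp: \<gamma>a right_normal_iff v_def WV gs)
    ultimately show ?thesis
      unfolding has_normal_curvature_def Faaa circ_aa using \<psi>
      by (intro exI conjI ballI) auto
  qed

  \<comment> \<open>From normal to circular curvature\<close>
  have circular_of_normal: "\<exists>k. has_circular_curvature F \<gamma> I s k"
    if s: "s \<in> I"
      and norm: "has_normal_curvature (assoc_gauge F) \<gamma>\<^sub>a (s\<^sub>a ` I) (s\<^sub>a s) k" for s k
  proof -
    obtain \<psi> v where \<psi>: "ccw_arclength_param (assoc_gauge (assoc_gauge (assoc_gauge F)))
          (unit_circle (assoc_gauge (assoc_gauge F))) \<psi>"
      and vc: "continuous_on (s\<^sub>a ` I) v"
      and rn: "\<And>r. r \<in> I \<Longrightarrow> right_normal (assoc_gauge F) (d r /\<^sub>R p r) (\<psi> (v (s\<^sub>a r)))"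
      and dv: "(v has_real_derivative k) (at (s\<^sub>a s) within s\<^sub>a ` I)"
      using norm unfolding has_normal_curvature_def by (metis \<gamma>a imageI)
    have minus_circ: "uminus ` unit_circle (assoc_gauge (assoc_gauge F)) = unit_circle F"
      unfolding circ_aa by (simp add: image_image)
    have minus_\<psi>: "ccw_arclength_param (assoc_gauge F) (unit_circle F) (\<lambda>x. - \<psi> x)"
      using ccw_arclength_param_uminus(1)[OF \<psi>] by (simp add: Faaa minus_circ)
    obtain V W where V: "\<And>x. (V has_real_derivative
          F (vector_derivative (\<lambda>x. - \<psi> x) (at x))) (at x)"
      and WV: "\<And>x. W (V x) = x"
      and vd: "\<And>x. vector_derivative ((\<lambda>x. - \<psi> x) \<circ> W) (at x) =
          vector_derivative (\<lambda>x. - \<psi> x) (at (W x)) /\<^sub>R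
            F (vector_derivative (\<lambda>x. - \<psi> x) (at (W x)))"
      and \<phi>: "ccw_arclength_param F (unit_circle F) ((\<lambda>x. - \<psi> x) \<circ> W)"
      by (rule arclength_reparam[OF Fa F minus_\<psi>]) blast
    have Vc: "continuous_on UNIV V"
      using V DERIV_isCont continuous_at_imp_continuous_on by blast
    define t where "t = V \<circ> (v \<circ> s\<^sub>a)"
    have "((v \<circ> s\<^sub>a) has_real_derivative k * p s) (at s within I)"
      by (rule DERIV_image_chain[OF dv ds'[OF s]])
    then have "(t has_real_derivative F (vector_derivative (\<lambda>x. - \<psi> x) (at (v (s\<^sub>a s)))) * (k * p s))
        (at s within I)"
      unfolding t_def using V[of "v (s\<^sub>a s)"] by (intro DERIV_chain[of V _ "v \<circ> s\<^sub>a"]) simp_all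
    moreover have "continuous_on I t"
      unfolding t_def using s_cont vc Vc
      by (metis continuous_on_compose continuous_on_subset subset_UNIV)
    \<comment> \<open>The velocity of \<open>- \<psi>\<close> is \<open>c *\<^sub>R d r\<close>. Its
      \<open>F\<close>-length is \<open>c\<close>, so normalizing leaves exactly
      \<open>d r\<close>.\<close>
    moreover have "d r = vector_derivative ((\<lambda>x. - \<psi> x) \<circ> W) (at (t r))" if r: "r \<in> I" for r
    proof -
      obtain c where "0 < c" "vector_derivative \<psi> (at (v (s\<^sub>a r))) = - (c *\<^sub>R d r)"
        using normal_velocity[OF \<psi> _ r] rn[OF r] by (auto simp: right_normal_iff[OF r])
      then show ?thesis
        using dF[OF r]
        by (simp add: vd t_def WV ccw_arclength_param_uminus(2)[OF \<psi>] gauge_scaleR[OF F])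
    qed
    ultimately show ?thesis
      unfolding has_circular_curvature_def d_def using \<phi> by blast
  qed

  \<comment> \<open>Equality of the two curvatures\<close>
  have curvatures_eq: "k = l"
    if s: "s \<in> I" and circ: "has_circular_curvature F \<gamma> I s k"
      and norm: "has_normal_curvature (assoc_gauge F) \<gamma>\<^sub>a (s\<^sub>a ` I) (s\<^sub>a s) l" for s k l
  proof -
    obtain \<phi> t where \<phi>: "ccw_arclength_param F (unit_circle F) \<phi>"
      and eq: "\<And>r. r \<in> I \<Longrightarrow> d r = vector_derivative \<phi> (at (t r))"
      and dt: "(t has_real_derivative k) (at s within I)"
      using circ unfolding has_circular_curvature_def d_def by blast
    obtain \<psi> v where \<psi>: "ccw_arclength_param (assoc_gauge (assoc_gauge (assoc_gauge F)))
          (unit_circle (assoc_gauge (assoc_gauge F))) \<psi>"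
      and rn: "\<And>r. r \<in> I \<Longrightarrow> right_normal (assoc_gauge F) (d r /\<^sub>R p r) (\<psi> (v (s\<^sub>a r)))"
      and dv: "(v has_real_derivative l) (at (s\<^sub>a s) within s\<^sub>a ` I)"
      using norm unfolding has_normal_curvature_def by (metis \<gamma>a imageI)
    have max: "F (- \<psi> (v (s\<^sub>a r))) = 1" "bracket (- \<psi> (v (s\<^sub>a r))) (d r) = assoc_gauge F (d r)"
      if "r \<in> I" for r
      using rn[OF that] by (simp_all add: right_normal_iff[OF that])
    \<comment> \<open>Both points maximize the bracket with \<open>d r\<close> on the unit circle,
      and strict convexity leaves room for only one.\<close>
    have same: "\<phi> (t r) = - \<psi> (v (s\<^sub>a r))" if r: "r \<in> I" for r
      using bracket_maximizer_unique[OF F sc d_nz[OF r]] circular_maximizer[OF \<phi> eq[OF r] r] max r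
      by metis
    obtain c where c: "0 < c" "vector_derivative \<psi> (at (v (s\<^sub>a s))) = - (c *\<^sub>R d s)"
      using normal_velocity[OF \<psi> max(2)[OF s] s] by blast
    have d\<psi>: "(\<psi> has_vector_derivative - (c *\<^sub>R d s)) (at (v (s\<^sub>a s)))"
      and unit: "assoc_gauge F (c *\<^sub>R d s) = 1"
      using \<psi> c(2) by (auto simp: ccw_arclength_param_def arclength_curve_on_def
          smooth_curve_on_def Faaa vector_derivative_works dest: spec[of _ "v (s\<^sub>a s)"])
    \<comment> \<open>The unit speed of \<open>\<psi>\<close> makes \<open>c\<close> the reciprocal
      of the derivative of \<open>s\<^sub>a\<close>, so the two factors cancel in the chain
      rule.\<close>
    have cp: "c * p s = 1" using unit c(1) by (simp add: gauge_scaleR[OF Fa] p_def)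
    have d\<phi>: "(\<phi> has_vector_derivative d s) (at (t s))"
      using \<phi> eq[OF s] by (auto simp: ccw_arclength_param_def arclength_curve_on_def
          smooth_curve_on_def vector_derivative_works)
    have "((\<phi> \<circ> t) has_vector_derivative k *\<^sub>R d s) (at s within I)"
      using dt has_vector_derivative_at_within[OF d\<phi>]
      by (intro vector_diff_chain_within) (auto simp: has_real_derivative_iff_has_vector_derivative)
    moreover have "((\<phi> \<circ> t) has_vector_derivative l *\<^sub>R d s) (at s within I)"
    proof -
      have "((v \<circ> s\<^sub>a) has_vector_derivative l * p s) (at s within I)"
        using DERIV_image_chain[OF dv ds'[OF s]]
        by (simp add: has_real_derivative_iff_has_vector_derivative)
      then have "(((\<lambda>x. - \<psi> x) \<circ> (v \<circ> s\<^sub>a)) has_vector_derivative (l * p s) *\<^sub>R - (- (c *\<^sub>R d s)))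
          (at s within I)"
        by (rule vector_diff_chain_within)
          (use has_vector_derivative_at_within[OF has_vector_derivative_minus[OF d\<psi>]] in simp)
      moreover have "(l * p s) *\<^sub>R - (- (c *\<^sub>R d s)) = l *\<^sub>R d s"
        using cp by (simp add: mult.commute mult.left_commute)
      ultimately have "(((\<lambda>x. - \<psi> x) \<circ> (v \<circ> s\<^sub>a)) has_vector_derivative l *\<^sub>R d s) (at s within I)"
        by metis
      then show ?thesis
        by (rule has_vector_derivative_transform[OF s, rotated]) (simp add: same)
    qed
    \<comment> \<open>The identity map, with derivative 1, serves as the change of parameter
      here.\<close>
    moreover have "at s within I \<noteq> bot"
      using at_within_pos_deriv_image_ne_bot[of I "\<lambda>x. x" "\<lambda>x. 1", OF I _ _ assms(5) s] by auto
    ultimately have "k *\<^sub>R d s = l *\<^sub>R d s"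
      using vector_derivative_unique_within by blast
    then show "k = l" using d_nz[OF s] by simp
  qed

  show ?thesis
    using normal_of_circular circular_of_normal curvatures_eq by blast
qed

end
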